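(* Let $\mu>0$, $-\mu^2/8<a<\mu^2$, and let $\varphi:\mathbb{R}\to\mathbb{R}$ with $\varphi\le\mu$ be a solution of $$-\mu\varphi+\tfrac12\varphi^2+\tfrac32L(\varphi^2)=a .$$ Then: (i) If $\varphi<\mu$ uniformly on $\mathbb{R}$ (i.e. $\sup_{\mathbb{R}}\varphi<\mu$), then $\varphi\in C^\infty(\mathbb{R})$ and all of its derivatives are uniformly bounded on $\mathbb{R}$. (ii) If $\varphi<\mu$ uniformly on $\mathbb{R}$ and $\varphi\in L^2(\mathbb{R})$, then $\varphi\in H^\infty(\mathbb{R})=\bigcap_{s\in\mathbb{R}}H^s(\mathbb{R})$. (iii) $\varphi$ is smooth on any open set where $\varphi<\mu$.
   Context: $L=(1-\partial_x^2)^{-1}$ is the operator $Lf=K*f$ on $\mathbb{R}$ with $K(x)=\frac12 e^{-|x|}$. A solution (with wave speed $\mu$) is a bounded measurable function $\varphi:\mathbb{R}\to\mathbb{R}$ satisfying the displayed equation at every point of $\mathbb{R}$. *)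

theory Defs
  imports "HOL-Analysis.Analysis"
begin

definition nth_deriv :: "nat \<Rightarrow> (real \<Rightarrow> 'a::real_normed_vector) \<Rightarrow> real \<Rightarrow> 'a" where
  "nth_deriv n f = ((\<lambda>g x. vector_derivative g (at x)) ^^ n) f"

text \<open>Intended for open sets only: the derivatives are two-sided derivatives in the real line.\<close>

definition smooth_on :: "real set \<Rightarrow> (real \<Rightarrow> 'a::real_normed_vector) \<Rightarrow> bool" where
  "smooth_on U f \<longleftrightarrow> (\<forall>n. \<forall>x\<in>U. nth_deriv n f differentiable (at x))"

definition L2 :: "(real \<Rightarrow> 'a::real_normed_vector) set" where
  "L2 = {f. f \<in> borel_measurable lebesgue \<and> integrable lebesgue (\<lambda>x. (norm (f x))\<^sup>2)}"

definition schwartz :: "(real \<Rightarrow> complex) set" where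
  "schwartz = {\<psi>. smooth_on UNIV \<psi> \<and>
     (\<forall>m n. bounded (range (\<lambda>x. of_real (x ^ m) * nth_deriv n \<psi> x)))}"

definition schwartz_seminorm :: "nat \<Rightarrow> nat \<Rightarrow> (real \<Rightarrow> complex) \<Rightarrow> real" where
  "schwartz_seminorm m n \<psi> = (SUP x. norm (of_real (x ^ m) * nth_deriv n \<psi> x))"

text \<open>A distribution is represented by a functional on all functions, of which only the
  values on Schwartz functions are relevant.\<close>

definition tempered_distribution :: "((real \<Rightarrow> complex) \<Rightarrow> complex) \<Rightarrow> bool" where
  "tempered_distribution T \<longleftrightarrow>
     (\<forall>\<psi>\<in>schwartz. \<forall>\<eta>\<in>schwartz. T (\<lambda>x. \<psi> x + \<eta> x) = T \<psi> + T \<eta>) \<and>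
     (\<forall>c. \<forall>\<psi>\<in>schwartz. T (\<lambda>x. c * \<psi> x) = c * T \<psi>) \<and>
     (\<exists>C N. \<forall>\<psi>\<in>schwartz. norm (T \<psi>) \<le> C * (\<Sum>m\<le>N. \<Sum>n\<le>N. schwartz_seminorm m n \<psi>))"

definition regular_distribution :: "(real \<Rightarrow> complex) \<Rightarrow> (real \<Rightarrow> complex) \<Rightarrow> complex" where
  "regular_distribution f \<psi> = (LINT x|lebesgue. f x * \<psi> x)"

definition fourier :: "(real \<Rightarrow> complex) \<Rightarrow> real \<Rightarrow> complex" where
  "fourier \<psi> \<xi> = (LINT x|lebesgue. exp (- (\<i> * of_real (x * \<xi>))) * \<psi> x)"

definition fourier_distribution ::
    "((real \<Rightarrow> complex) \<Rightarrow> complex) \<Rightarrow> (real \<Rightarrow> complex) \<Rightarrow> complex" where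
  "fourier_distribution T \<psi> = T (fourier \<psi>)"

text \<open>Tempered distributions whose Fourier transform is a function \<open>g\<close> with
  \<open>(1 + \<xi>\<^sup>2)\<^bsup>s/2\<^esup> g\<close> square integrable; the order \<open>s\<close> may be negative.\<close>

definition sobolev :: "real \<Rightarrow> ((real \<Rightarrow> complex) \<Rightarrow> complex) set" where
  "sobolev s = {T. tempered_distribution T \<and>
     (\<exists>g. (\<lambda>\<xi>. of_real ((1 + \<xi>\<^sup>2) powr (s / 2)) * g \<xi>) \<in> L2 \<and>
        (\<forall>\<psi>\<in>schwartz. fourier_distribution T \<psi> = regular_distribution g \<psi>))}"

text \<open>The integrability condition makes the regular distribution of \<open>f\<close> meaningful; without it
  the Bochner integral would default to 0.\<close>

definition sobolev_fun :: "real \<Rightarrow> (real \<Rightarrow> complex) set" where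
  "sobolev_fun s = {f. f \<in> borel_measurable lebesgue \<and>
     (\<forall>\<psi>\<in>schwartz. integrable lebesgue (\<lambda>x. f x * \<psi> x)) \<and>
     regular_distribution f \<in> sobolev s}"

definition sobolev_inf :: "(real \<Rightarrow> complex) set" where
  "sobolev_inf = (\<Inter>s. sobolev_fun s)"

definition Kker :: "real \<Rightarrow> real" where
  "Kker x = exp (- \<bar>x\<bar>) / 2"

definition Lop :: "(real \<Rightarrow> real) \<Rightarrow> real \<Rightarrow> real" where
  "Lop f x = (LINT y|lebesgue. Kker (x - y) * f y)"

definition is_solution :: "real \<Rightarrow> real \<Rightarrow> (real \<Rightarrow> real) \<Rightarrow> bool" where
  "is_solution \<mu> a \<phi> \<longleftrightarrow> bounded (range \<phi>) \<and> \<phi> \<in> borel_measurable lebesgue \<and>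
     (\<forall>x. - \<mu> * \<phi> x + 1/2 * (\<phi> x)\<^sup>2 + 3/2 * Lop (\<lambda>y. (\<phi> y)\<^sup>2) x = a)"

end

theory Submission
  imports Defs
begin

text \<open>Put \<open>w = L(\<phi>\<^sup>2)\<close>. Completing the square turns the equation into
  \<open>(\<mu> - \<phi>)\<^sup>2 = \<mu>\<^sup>2 + 2a - 3w\<close>, and since \<open>\<phi> \<le> \<mu>\<close> the sign of the root is known:
  \<open>\<phi> = \<mu> - \<sigma>\<close> with \<open>\<sigma> = sqrt (\<mu>\<^sup>2 + 2a - 3w)\<close>. As \<open>w\<close> is continuous for any bounded \<open>\<phi>\<close>
  (\<open>isCont_Lop\<close>), so is \<open>\<phi>\<close>, and then the two-sided exponential kernel gives
  \<open>w'' = w - \<phi>\<^sup>2\<close> in the classical sense (\<open>has_derivative_Lop\<close>, \<open>has_derivative_Lop'\<close>).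

  Regularity is not bootstrapped order by order. Where \<open>\<sigma> \<noteq> 0\<close> the derivatives of
  \<open>w, w', \<sigma>, 1/\<sigma>\<close> are polynomials in these same four functions, so the algebra they generate is
  stable under differentiation; it contains \<open>\<phi>\<close>, hence \<open>\<phi>\<close> is smooth there. If \<open>\<sigma>\<close> is bounded
  below by a positive constant, the four generators are bounded, and so is every element of the
  algebra, in particular every derivative of \<open>\<phi>\<close>.

  For the Sobolev part, let \<open>\<phi>\<close> be square integrable as well. Then \<open>\<phi>\<^sup>2\<close> and \<open>w\<close> are integrable, hence so
  is \<open>a + \<mu>\<phi> = \<phi>\<^sup>2/2 + 3w/2\<close>; comparing this bounded integrable function with
  the square integrable \<open>\<mu>\<phi>\<close> forces \<open>a = 0\<close>, and \<open>\<phi>\<close> itself is integrable. The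
  ideal generated by \<open>w, w', \<phi>\<close> in the algebra is again stable under differentiation, and all
  its elements are integrable. So all derivatives of \<open>\<phi>\<close> are in \<open>L\<^sup>1\<close>, and
  \<open>(1 + \<xi>\<^sup>2)\<^sup>k\<close> times the Fourier transform of \<open>\<phi>\<close> is bounded for every \<open>k\<close>, as the
  transform of \<open>(1 - d\<^sup>2/dx\<^sup>2)\<^sup>k \<phi>\<close> (\<open>fourier_rapid_decay\<close>). Working in \<open>L\<^sup>1\<close> keeps the
  Fourier transform an absolutely convergent integral, and Fubini's theorem identifies it with the
  distributional one; the \<open>L\<^sup>2\<close> theory is avoided.\<close>

section \<open>Integrability of the kernel\<close>

lemma integrable_Cauchy_kernel: "integrable lborel (\<lambda>x::real. 1 / (1 + x\<^sup>2))"
proof -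
  have "set_integrable lborel (einterval (-\<infinity>) \<infinity>) (\<lambda>x::real. 1 / (1 + x\<^sup>2))"
  proof (rule interval_integral_FTC_nonneg(1)[where F = arctan and A = "-pi/2" and B = "pi/2"])
    show "((arctan \<circ> real_of_ereal) \<longlongrightarrow> - pi / 2) (at_right (- \<infinity>))"
      using tendsto_arctan_at_bot by (simp add: ereal_tendsto_simps)
    show "((arctan \<circ> real_of_ereal) \<longlongrightarrow> pi / 2) (at_left \<infinity>)"
      using tendsto_arctan_at_top by (simp add: ereal_tendsto_simps)
    show "isCont (\<lambda>x::real. 1 / (1 + x\<^sup>2)) x" for x :: real
      by (intro continuous_intros) (simp add: add_nonneg_eq_0_iff)
    show "DERIV arctan x :> 1 / (1 + x\<^sup>2)" for x :: real
      by (rule derivative_eq_intros refl | simp add: inverse_eq_divide)+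
  qed auto
  then show ?thesis
    by (simp add: set_integrable_def)
qed

lemma Kker_nonneg: "0 \<le> Kker x"
  by (simp add: Kker_def)

text \<open>Comparison with \<open>1 / (1 + x\<^sup>2)\<close>, which has the antiderivative \<open>arctan\<close> on the whole line,
  makes the kernel integrable; the same comparison function serves for Schwartz functions and
  for Fourier transforms.\<close>

lemma Kker_le_Cauchy_kernel: "Kker x \<le> 1 / (1 + x\<^sup>2)"
proof -
  have "(1 + x\<^sup>2) / 2 \<le> 1 + \<bar>x\<bar> + \<bar>x\<bar>\<^sup>2 / 2"
    by simp
  also have "\<dots> \<le> exp \<bar>x\<bar>"
    by (rule exp_lower_Taylor_quadratic) simp
  finally have *: "(1 + x\<^sup>2) / 2 \<le> exp \<bar>x\<bar>" .
  have "0 < 1 + x\<^sup>2"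
    by (simp add: add_pos_nonneg)
  then show ?thesis
    using * by (simp add: Kker_def exp_minus field_simps)
qed

lemma Kker_measurable [measurable]: "Kker \<in> borel_measurable borel"
  unfolding Kker_def by measurable

lemma integrable_Kker: "integrable lborel Kker"
  by (rule Bochner_Integration.integrable_bound[OF integrable_Cauchy_kernel])
    (use Kker_le_Cauchy_kernel in \<open>auto simp: Kker_nonneg abs_of_nonneg\<close>)

lemma integrable_Kker_diff: "integrable lborel (\<lambda>y. Kker (x - y))"
  using lborel_integrable_real_affine[OF integrable_Kker, of "-1" x] by simp

lemma integrable_Kker_mult:
  assumes "g \<in> borel_measurable lebesgue" and "\<And>y. \<bar>g y\<bar> \<le> M"
  shows "integrable lebesgue (\<lambda>y. Kker (x - y) * g y)"
proof (rule Bochner_Integration.integrable_bound)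
  show "integrable lebesgue (\<lambda>y. M * Kker (x - y))"
    using integrable_Kker_diff by (simp add: integrable_completion)
  show "(\<lambda>y. Kker (x - y) * g y) \<in> borel_measurable lebesgue"
  proof (rule borel_measurable_times)
    show "(\<lambda>y. Kker (x - y)) \<in> borel_measurable lebesgue"
      by (rule measurable_completion) measurable
  qed (rule assms)
  have "\<bar>Kker (x - y) * g y\<bar> \<le> \<bar>M * Kker (x - y)\<bar>" for y
    using mult_right_mono[OF assms(2)[of y] Kker_nonneg[of "x - y"]] Kker_nonneg[of "x - y"]
      abs_ge_self[of "M * Kker (x - y)"]
    by (simp add: abs_mult mult.commute)
  then show "AE y in lebesgue. norm (Kker (x - y) * g y) \<le> norm (M * Kker (x - y))"
    by simp
qed

section \<open>The convolution operator L\<close>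

lemma Lop_nonneg: "(\<And>y. 0 \<le> g y) \<Longrightarrow> 0 \<le> Lop g x"
  unfolding Lop_def by (intro Bochner_Integration.integral_nonneg) (simp add: Kker_nonneg)

text \<open>Moving the argument of the kernel by \<open>h\<close> changes its value by a factor of at most
  \<open>exp \<bar>h\<bar>\<close>, and this passes to the convolution with a nonnegative function. It gives continuity
  of \<open>L g\<close> for bounded measurable \<open>g \<ge> 0\<close>.\<close>

lemma Lop_Harnack:
  assumes g: "g \<in> borel_measurable lebesgue" "\<And>y. 0 \<le> g y" "\<And>y. \<bar>g y\<bar> \<le> M"
  shows "Lop g x \<le> exp \<bar>x - z\<bar> * Lop g z"
proof -
  have le: "Kker (x - y) \<le> exp \<bar>x - z\<bar> * Kker (z - y)" for y
    by (simp add: Kker_def flip: exp_add)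
  have "Lop g x \<le> (LINT y|lebesgue. exp \<bar>x - z\<bar> * (Kker (z - y) * g y))"
    unfolding Lop_def
  proof (rule integral_mono)
    show "Kker (x - y) * g y \<le> exp \<bar>x - z\<bar> * (Kker (z - y) * g y)" for y
      using mult_right_mono[OF le g(2)] by (simp add: mult.assoc)
  qed (use integrable_Kker_mult[OF g(1,3)] in auto)
  also have "\<dots> = exp \<bar>x - z\<bar> * Lop g z"
    by (simp add: Lop_def)
  finally show ?thesis .
qed

lemma isCont_Lop:
  assumes g: "g \<in> borel_measurable lebesgue" "\<And>y. 0 \<le> g y" "\<And>y. \<bar>g y\<bar> \<le> M"
  shows "isCont (Lop g) z"
  unfolding isCont_def
proof (rule tendsto_sandwich)
  have up: "Lop g x \<le> exp \<bar>x - z\<bar> * Lop g z" for x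
    by (rule Lop_Harnack[OF g])
  have "exp (- \<bar>x - z\<bar>) * Lop g z \<le> Lop g x" for x
    using Lop_Harnack[OF g, of z x] by (simp add: exp_minus abs_minus_commute field_simps)
  then show "\<forall>\<^sub>F x in at z. exp (- \<bar>x - z\<bar>) * Lop g z \<le> Lop g x"
    by simp
  show "\<forall>\<^sub>F x in at z. Lop g x \<le> exp \<bar>x - z\<bar> * Lop g z"
    using up by simp
  have "((\<lambda>x. exp (- \<bar>x - z\<bar>) * Lop g z) \<longlongrightarrow> exp (- \<bar>z - z\<bar>) * Lop g z) (at z)"
    by (intro tendsto_intros)
  then show "((\<lambda>x. exp (- \<bar>x - z\<bar>) * Lop g z) \<longlongrightarrow> Lop g z) (at z)"
    by simp
  have "((\<lambda>x. exp \<bar>x - z\<bar> * Lop g z) \<longlongrightarrow> exp \<bar>z - z\<bar> * Lop g z) (at z)"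
    by (intro tendsto_intros)
  then show "((\<lambda>x. exp \<bar>x - z\<bar> * Lop g z) \<longlongrightarrow> Lop g z) (at z)"
    by simp
qed

text \<open>The fundamental theorem of calculus on a half-line: near \<open>x\<close> the integral differs from one
  over a compact interval by a constant.\<close>

lemma has_derivative_integral_atMost:
  fixes f :: "real \<Rightarrow> real"
  assumes cont: "continuous_on UNIV f" and int: "\<And>x. set_integrable lborel {..x} f"
  shows "((\<lambda>x. LINT y:{..x}|lborel. f y) has_real_derivative f x) (at x)"
proof -
  define c where "c = x - 1"
  have split: "(LINT y:{..u}|lborel. f y) = (LINT y:{..<c}|lborel. f y) + integral {c..u} f"
    if "c < u" for u
  proof -
    have un: "{..u} = {..<c} \<union> {c..u}"
      using that by auto
    have i1: "set_integrable lborel {..<c} f"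
      by (rule set_integrable_subset[OF int[of c]]) auto
    have i2: "set_integrable lborel {c..u} f"
      by (rule set_integrable_subset[OF int[of u]]) auto
    have "(LINT y:{..u}|lborel. f y) = (LINT y:{..<c}|lborel. f y) + (LINT y:{c..u}|lborel. f y)"
      unfolding un by (rule set_integral_Un[OF _ i1 i2]) auto
    then show ?thesis
      using set_borel_integral_eq_integral(2)[OF i2] by simp
  qed
  have "((\<lambda>u. integral {c..u} f) has_real_derivative f x) (at x within {c..x+1})"
    by (rule integral_has_real_derivative) (auto simp: c_def intro: continuous_on_subset[OF cont])
  then have "((\<lambda>u. integral {c..u} f) has_real_derivative f x) (at x)"
    by (simp add: at_within_Icc_at c_def)
  then have "((\<lambda>u. (LINT y:{..<c}|lborel. f y) + integral {c..u} f) has_real_derivative f x) (at x)"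
    by (auto intro!: derivative_eq_intros)
  then show ?thesis
    by (rule has_field_derivative_transform_within_open[where S = "{c<..}"])
      (auto simp: split c_def)
qed

text \<open>Splitting \<open>\<integral> exp (-\<bar>x-y\<bar>) g y dy\<close> at \<open>y = x\<close> leaves two integrals whose integrands are
  products of a function of \<open>x\<close> and a function of \<open>y\<close>, so that each can be differentiated by the
  fundamental theorem. This is the part \<open>y \<le> x\<close>; the other part is its mirror image.\<close>

definition left_conv :: "(real \<Rightarrow> real) \<Rightarrow> real \<Rightarrow> real" where
  "left_conv g x = exp (-x) * (LINT y:{..x}|lborel. exp y * g y)"

lemma set_integrable_exp_atMost:
  fixes g :: "real \<Rightarrow> real"
  assumes g: "continuous_on UNIV g" "\<And>y. \<bar>g y\<bar> \<le> M"
  shows "set_integrable lborel {..x} (\<lambda>y. exp y * g y)"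
  unfolding set_integrable_def
proof (rule Bochner_Integration.integrable_bound)
  show "integrable lborel (\<lambda>y. 2 * M * exp x * Kker (x - y))"
    using integrable_Kker_diff by simp
  have [measurable]: "g \<in> borel_measurable borel"
    using g(1) by (rule borel_measurable_continuous_onI)
  show "(\<lambda>y. indicat_real {..x} y *\<^sub>R (exp y * g y)) \<in> borel_measurable lborel"
    by measurable
  have "\<bar>indicat_real {..x} y * (exp y * g y)\<bar> \<le> \<bar>2 * M * exp x * Kker (x - y)\<bar>" for y
  proof (cases "y \<le> x")
    case True
    have "2 * M * exp x * Kker (x - y) = exp y * M"
      using True by (simp add: Kker_def exp_minus exp_diff)
    moreover have "\<bar>exp y * g y\<bar> \<le> exp y * M"
      using g(2)[of y] by (simp add: abs_mult)
    ultimately have "\<bar>exp y * g y\<bar> \<le> \<bar>2 * M * exp x * Kker (x - y)\<bar>"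
      by linarith
    then show ?thesis
      using True by simp
  qed auto
  then show "AE y in lborel. norm (indicat_real {..x} y *\<^sub>R (exp y * g y))
      \<le> norm (2 * M * exp x * Kker (x - y))"
    by simp
qed

lemma has_derivative_left_conv:
  assumes g: "continuous_on UNIV g" "\<And>y. \<bar>g y\<bar> \<le> M"
  shows "(left_conv g has_real_derivative g x - left_conv g x) (at x)"
proof -
  have "((\<lambda>x. LINT y:{..x}|lborel. exp y * g y) has_real_derivative exp x * g x) (at x)"
    by (rule has_derivative_integral_atMost)
      (intro continuous_intros g(1) set_integrable_exp_atMost[OF g])+
  then have "((\<lambda>x. exp (-x) * (LINT y:{..x}|lborel. exp y * g y)) has_real_derivative
      exp (-x) * (exp x * g x) + (- exp (-x)) * (LINT y:{..x}|lborel. exp y * g y)) (at x)"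
    by (auto intro!: derivative_eq_intros)
  then show ?thesis
    unfolding left_conv_def by (simp add: exp_minus flip: mult.assoc)
qed

lemma left_conv_nonneg: "(\<And>y. 0 \<le> g y) \<Longrightarrow> 0 \<le> left_conv g x"
  unfolding left_conv_def set_lebesgue_integral_def
  by (intro mult_nonneg_nonneg Bochner_Integration.integral_nonneg) auto

definition right_conv :: "(real \<Rightarrow> real) \<Rightarrow> real \<Rightarrow> real" where
  "right_conv g x = left_conv (\<lambda>y. g (- y)) (- x)"

lemma has_derivative_right_conv:
  assumes g: "continuous_on UNIV g" "\<And>y. \<bar>g y\<bar> \<le> M"
  shows "(right_conv g has_real_derivative right_conv g x - g x) (at x)"
proof -
  have "continuous_on UNIV (\<lambda>y. g (- y))"
    by (intro continuous_on_compose2[OF g(1)] continuous_intros) auto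
  from has_derivative_left_conv[OF this, of M "-x"] g(2)
  have "(left_conv (\<lambda>y. g (- y)) has_real_derivative g x - right_conv g x) (at (- x))"
    by (simp add: right_conv_def)
  moreover have "(uminus has_real_derivative -1) (at x)"
    by (auto intro!: derivative_eq_intros)
  ultimately have "((\<lambda>x. left_conv (\<lambda>y. g (- y)) (- x)) has_real_derivative
      (g x - right_conv g x) * -1) (at x)"
    by (rule DERIV_chain2)
  then show ?thesis
    by (simp add: right_conv_def[abs_def])
qed

lemma Lop_eq_left_right:
  assumes g: "continuous_on UNIV g" "\<And>y. \<bar>g y\<bar> \<le> M"
  shows "Lop g x = (left_conv g x + right_conv g x) / 2"
proof -
  have [measurable]: "g \<in> borel_measurable borel"
    using g(1) by (rule borel_measurable_continuous_onI)
  have g': "continuous_on UNIV (\<lambda>y. g (- y))"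
    by (intro continuous_on_compose2[OF g(1)] continuous_intros) auto
  let ?l = "\<lambda>y. exp (-x) / 2 * (indicator {..x} y * (exp y * g y))"
  let ?r = "\<lambda>y. exp x / 2 * (indicator {..-x} y * (exp y * g (- y)))"
  have l: "integrable lborel ?l"
    using set_integrable_exp_atMost[OF g, of x] by (simp add: set_integrable_def)
  have r: "integrable lborel ?r"
    using set_integrable_exp_atMost[OF g', of M "-x"] g(2) by (simp add: set_integrable_def)
  have r': "integrable lborel (\<lambda>y. ?r (- y))"
    using lborel_integrable_real_affine[OF r, of "-1" 0] by simp
  have "Lop g x = (LINT y|lborel. Kker (x - y) * g y)"
    unfolding Lop_def by (rule integral_completion) measurable
  also have "\<dots> = (LINT y|lborel. ?l y + ?r (- y))"
  proof (rule integral_cong_AE)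
    have "AE y in lborel. y \<noteq> x"
      by (rule AE_lborel_singleton)
    then show "AE y in lborel. Kker (x - y) * g y = ?l y + ?r (- y)"
    proof eventually_elim
      case (elim y)
      then consider "y < x" | "x < y"
        by linarith
      then show ?case
      proof cases
        case 1
        then show ?thesis
          by (simp add: Kker_def flip: exp_add mult.assoc)
      next
        case 2
        then show ?thesis
          by (simp add: Kker_def flip: exp_add mult.assoc)
      qed
    qed
  qed measurable
  also have "\<dots> = (LINT y|lborel. ?l y) + (LINT y|lborel. ?r (- y))"
    using l r' by (rule Bochner_Integration.integral_add)
  also have "(LINT y|lborel. ?r (- y)) = (LINT y|lborel. ?r y)"
    using lborel_integral_real_affine[of "-1" ?r 0] by simp
  also have "(LINT y|lborel. ?l y) + (LINT y|lborel. ?r y) = (left_conv g x + right_conv g x) / 2"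
    by (simp add: left_conv_def right_conv_def set_lebesgue_integral_def)
  finally show ?thesis .
qed

text \<open>The derivative of \<open>L g\<close>, that is \<open>K' * g\<close>: the boundary terms of the two halves cancel.\<close>

definition Lop' :: "(real \<Rightarrow> real) \<Rightarrow> real \<Rightarrow> real" where
  "Lop' g x = (right_conv g x - left_conv g x) / 2"

lemma has_derivative_Lop:
  assumes g: "continuous_on UNIV g" "\<And>y. \<bar>g y\<bar> \<le> M"
  shows "(Lop g has_real_derivative Lop' g x) (at x)"
proof -
  have "Lop g = (\<lambda>x. (left_conv g x + right_conv g x) / 2)"
    using Lop_eq_left_right[OF g] by blast
  moreover have "((\<lambda>x. (left_conv g x + right_conv g x) / 2) has_real_derivative
      ((g x - left_conv g x) + (right_conv g x - g x)) / 2) (at x)"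
    by (intro DERIV_cdivide DERIV_add has_derivative_left_conv[OF g] has_derivative_right_conv[OF g])
  ultimately show ?thesis
    by (simp add: Lop'_def)
qed

text \<open>Here the boundary terms add up to \<open>- g x\<close>: this is \<open>(1 - d\<^sup>2/dx\<^sup>2) L g = g\<close>.\<close>

lemma has_derivative_Lop':
  assumes g: "continuous_on UNIV g" "\<And>y. \<bar>g y\<bar> \<le> M"
  shows "(Lop' g has_real_derivative Lop g x - g x) (at x)"
proof -
  have "((\<lambda>x. (right_conv g x - left_conv g x) / 2) has_real_derivative
      ((right_conv g x - g x) - (g x - left_conv g x)) / 2) (at x)"
    by (intro DERIV_cdivide DERIV_diff has_derivative_left_conv[OF g] has_derivative_right_conv[OF g])
  then show ?thesis
    unfolding Lop'_def[abs_def] Lop_eq_left_right[OF g] by (simp add: field_simps)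
qed

text \<open>Since \<open>\<bar>K'\<bar> = K\<close>. Boundedness and integrability of the derivative thus come for free from
  those of \<open>L g\<close>.\<close>

lemma abs_Lop'_le:
  assumes g: "continuous_on UNIV g" "\<And>y. \<bar>g y\<bar> \<le> M" "\<And>y. 0 \<le> g y"
  shows "\<bar>Lop' g x\<bar> \<le> Lop g x"
  using left_conv_nonneg[of g x] left_conv_nonneg[of "\<lambda>y. g (- y)" "- x"] g(3)
  unfolding Lop_eq_left_right[OF g(1,2)] Lop'_def right_conv_def by (auto simp: abs_le_iff)

lemma Lop_le:
  assumes "g \<in> borel_measurable lebesgue" "\<And>y. \<bar>g y\<bar> \<le> M"
  shows "Lop g x \<le> M * (LINT y|lborel. Kker y)"
proof -
  have "Lop g x \<le> (LINT y|lebesgue. M * Kker (x - y))"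
    unfolding Lop_def
  proof (rule integral_mono)
    show "Kker (x - y) * g y \<le> M * Kker (x - y)" for y
      using mult_left_mono[OF abs_le_D1[OF assms(2)[of y]] Kker_nonneg[of "x - y"]]
      by (simp add: mult.commute)
    show "integrable lebesgue (\<lambda>y. M * Kker (x - y))"
      using integrable_Kker_diff by (simp add: integrable_completion)
  qed (rule integrable_Kker_mult[OF assms])
  also have "\<dots> = (LINT y|lborel. M * Kker (x - y))"
    by (rule integral_completion) measurable
  also have "\<dots> = M * (LINT y|lborel. Kker y)"
    using lborel_integral_real_affine[of "-1" Kker x] by simp
  finally show ?thesis .
qed

text \<open>Tonelli: the \<open>L\<^sup>1\<close> norm of a convolution is at most the product of the norms.\<close>

lemma integrable_Lop:
  assumes g: "integrable lborel g" "\<And>y. 0 \<le> g y"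
  shows "integrable lborel (Lop g)"
proof -
  have [measurable]: "g \<in> borel_measurable borel"
    using g(1) by auto
  have "integrable (lborel \<Otimes>\<^sub>M lborel) (\<lambda>(y, x). Kker (x - y) * g y)"
  proof (rule lborel_pair.Fubini_integrable)
    have "(LINT x|lborel. Kker (x - y)) = (LINT x|lborel. Kker x)" for y
      using lborel_integral_real_affine[of 1 Kker "-y"] by simp
    then have "(LINT x|lborel. norm (case (y, x) of (y, x) \<Rightarrow> Kker (x - y) * g y)) =
        (LINT x|lborel. Kker x) * g y" for y
      by (simp add: abs_mult Kker_nonneg g(2))
    then show "integrable lborel (\<lambda>y. LINT x|lborel. norm (case (y, x) of (y, x) \<Rightarrow> Kker (x - y) * g y))"
      using g(1) by simp
    have "integrable lborel (\<lambda>x. Kker (x - y))" for y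
      using lborel_integrable_real_affine[OF integrable_Kker, of 1 "-y"] by simp
    then show "AE y in lborel. integrable lborel (\<lambda>x. case (y, x) of (y, x) \<Rightarrow> Kker (x - y) * g y)"
      by simp
  qed measurable
  then have "integrable lborel (\<lambda>x. LINT y|lborel. Kker (x - y) * g y)"
    by (rule lborel_pair.integrable_snd)
  moreover have "Lop g = (\<lambda>x. LINT y|lborel. Kker (x - y) * g y)"
    unfolding Lop_def by (intro ext integral_completion) measurable
  ultimately show ?thesis
    by simp
qed

section \<open>Classes of functions closed under differentiation\<close>

lemma nth_deriv_0 [simp]: "nth_deriv 0 f = f"
  by (simp add: nth_deriv_def)

lemma nth_deriv_Suc: "nth_deriv (Suc n) f x = vector_derivative (nth_deriv n f) (at x)"
  by (simp add: nth_deriv_def)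

text \<open>The iterated derivatives of \<open>f\<close> are functions on the whole line, whereas derivatives in \<open>C\<close>
  are only required to be correct on \<open>U\<close>. Openness of \<open>U\<close> lets the values on \<open>U\<close> determine the
  next derivative there.\<close>

lemma nth_deriv_in_class:
  assumes U: "open U"
    and closed: "\<And>f. f \<in> C \<Longrightarrow> \<exists>f'\<in>C. \<forall>x\<in>U. (f has_vector_derivative f' x) (at x)"
    and f: "f \<in> C"
  shows "\<exists>g\<in>C. \<forall>x\<in>U. nth_deriv n f x = g x"
proof (induction n)
  case 0
  then show ?case
    using f by auto
next
  case (Suc n)
  then obtain g where g: "g \<in> C" "\<forall>x\<in>U. nth_deriv n f x = g x"
    by blast
  from closed[OF g(1)] obtain g' where g': "g' \<in> C" "\<forall>x\<in>U. (g has_vector_derivative g' x) (at x)"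
    by blast
  have "(nth_deriv n f has_vector_derivative g' x) (at x)" if "x \<in> U" for x
    by (rule has_vector_derivative_transform_within_open[OF _ U that, of g])
      (use g(2) g'(2) that in auto)
  then have "\<forall>x\<in>U. nth_deriv (Suc n) f x = g' x"
    by (simp add: nth_deriv_Suc vector_derivative_at)
  with g'(1) show ?case
    by blast
qed

lemma smooth_on_class:
  assumes U: "open U"
    and closed: "\<And>f. f \<in> C \<Longrightarrow> \<exists>f'\<in>C. \<forall>x\<in>U. (f has_vector_derivative f' x) (at x)"
    and f: "f \<in> C"
  shows "smooth_on U f"
  unfolding smooth_on_def
proof (intro allI ballI)
  fix n x
  assume x: "x \<in> U"
  obtain g where g: "g \<in> C" "\<forall>x\<in>U. nth_deriv n f x = g x"
    using nth_deriv_in_class[OF U closed f] by blast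
  from closed[OF g(1)] obtain g' where g': "\<forall>x\<in>U. (g has_vector_derivative g' x) (at x)"
    by blast
  have "(nth_deriv n f has_vector_derivative g' x) (at x)"
    by (rule has_vector_derivative_transform_within_open[OF _ U x, of g]) (use g(2) g' x in auto)
  then show "nth_deriv n f differentiable (at x)"
    by (rule differentiableI_vector)
qed

inductive_set fun_algebra :: "(real \<Rightarrow> real) set \<Rightarrow> (real \<Rightarrow> real) set" for G where
  const: "(\<lambda>x. c) \<in> fun_algebra G"
| gen: "f \<in> G \<Longrightarrow> f \<in> fun_algebra G"
| add: "f \<in> fun_algebra G \<Longrightarrow> g \<in> fun_algebra G \<Longrightarrow> (\<lambda>x. f x + g x) \<in> fun_algebra G"
| mult: "f \<in> fun_algebra G \<Longrightarrow> g \<in> fun_algebra G \<Longrightarrow> (\<lambda>x. f x * g x) \<in> fun_algebra G"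

text \<open>The ideal generated by \<open>J\<close>, but over the algebra generated by \<open>G\<close> alone; \<open>J\<close> need not lie
  in that algebra. Boundedness is a property of the algebra, integrability one of the ideal.\<close>

inductive_set fun_ideal :: "(real \<Rightarrow> real) set \<Rightarrow> (real \<Rightarrow> real) set \<Rightarrow> (real \<Rightarrow> real) set"
  for G J where
  gen: "f \<in> J \<Longrightarrow> f \<in> fun_ideal G J"
| add: "f \<in> fun_ideal G J \<Longrightarrow> g \<in> fun_ideal G J \<Longrightarrow> (\<lambda>x. f x + g x) \<in> fun_ideal G J"
| mult: "f \<in> fun_algebra G \<Longrightarrow> g \<in> fun_ideal G J \<Longrightarrow> (\<lambda>x. f x * g x) \<in> fun_ideal G J"

text \<open>By the sum and product rules only the generators have to be inspected.\<close>

lemma fun_algebra_deriv: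
  assumes gens: "\<And>f. f \<in> G \<Longrightarrow> \<exists>f'\<in>fun_algebra G. \<forall>x\<in>U. (f has_real_derivative f' x) (at x)"
    and f: "f \<in> fun_algebra G"
  shows "\<exists>f'\<in>fun_algebra G. \<forall>x\<in>U. (f has_real_derivative f' x) (at x)"
  using f
proof induction
  case (const c)
  show ?case
    by (rule bexI[of _ "\<lambda>x. 0"]) (auto intro: fun_algebra.const)
next
  case (gen f)
  then show ?case
    by (rule gens)
next
  case (add f g)
  then obtain f' g' where "f' \<in> fun_algebra G" "g' \<in> fun_algebra G"
    "\<forall>x\<in>U. (f has_real_derivative f' x) (at x)" "\<forall>x\<in>U. (g has_real_derivative g' x) (at x)"
    by blast
  then show ?case
    by (intro bexI[of _ "\<lambda>x. f' x + g' x"]) (auto intro: fun_algebra.add DERIV_add)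
next
  case (mult f g)
  then obtain f' g' where "f' \<in> fun_algebra G" "g' \<in> fun_algebra G"
    "\<forall>x\<in>U. (f has_real_derivative f' x) (at x)" "\<forall>x\<in>U. (g has_real_derivative g' x) (at x)"
    by blast
  with mult.hyps show ?case
    by (intro bexI[of _ "\<lambda>x. f' x * g x + g' x * f x"])
      (auto intro: fun_algebra.add fun_algebra.mult DERIV_mult)
qed

lemma fun_ideal_deriv:
  assumes gens: "\<And>f. f \<in> G \<Longrightarrow> \<exists>f'\<in>fun_algebra G. \<forall>x\<in>U. (f has_real_derivative f' x) (at x)"
    and igens: "\<And>f. f \<in> J \<Longrightarrow> \<exists>f'\<in>fun_ideal G J. \<forall>x\<in>U. (f has_real_derivative f' x) (at x)"
    and f: "f \<in> fun_ideal G J"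
  shows "\<exists>f'\<in>fun_ideal G J. \<forall>x\<in>U. (f has_real_derivative f' x) (at x)"
  using f
proof induction
  case (gen f)
  then show ?case
    by (rule igens)
next
  case (add f g)
  then obtain f' g' where "f' \<in> fun_ideal G J" "g' \<in> fun_ideal G J"
    "\<forall>x\<in>U. (f has_real_derivative f' x) (at x)" "\<forall>x\<in>U. (g has_real_derivative g' x) (at x)"
    by blast
  then show ?case
    by (intro bexI[of _ "\<lambda>x. f' x + g' x"]) (auto intro: fun_ideal.add DERIV_add)
next
  case (mult f g)
  obtain f' where "f' \<in> fun_algebra G" "\<forall>x\<in>U. (f has_real_derivative f' x) (at x)"
    using fun_algebra_deriv[OF gens mult.hyps(1)] by blast
  moreover obtain g' where "g' \<in> fun_ideal G J" "\<forall>x\<in>U. (g has_real_derivative g' x) (at x)"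
    using mult.IH by blast
  ultimately show ?case
    using mult.hyps
    by (intro bexI[of _ "\<lambda>x. f' x * g x + f x * g' x"])
      (auto intro!: fun_ideal.add fun_ideal.mult derivative_eq_intros)
qed

lemma fun_algebra_bounded:
  assumes "\<And>f. f \<in> G \<Longrightarrow> bounded (range f)" and "f \<in> fun_algebra G"
  shows "bounded (range f)"
  using assms(2)
proof induction
  case (add f g)
  then show ?case
    using bounded_plus_comp[of f UNIV g] by simp
next
  case (mult f g)
  then obtain A B where "\<And>x. \<bar>f x\<bar> \<le> A" "\<And>x. \<bar>g x\<bar> \<le> B"
    by (auto simp: bounded_iff)
  then have "\<bar>f x * g x\<bar> \<le> A * B" for x
    unfolding abs_mult by (intro mult_mono) (auto intro: order_trans[OF abs_ge_zero])
  then show ?case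
    by (auto simp: bounded_iff)
qed (use assms(1) in auto)

lemma fun_algebra_measurable:
  assumes "G \<subseteq> borel_measurable borel" and "f \<in> fun_algebra G"
  shows "f \<in> borel_measurable borel"
  using assms(2) by induction (use assms(1) in auto)

lemma integrable_bounded_mult:
  fixes f g :: "real \<Rightarrow> real"
  assumes f: "f \<in> borel_measurable borel" "bounded (range f)" and g: "integrable lborel g"
  shows "integrable lborel (\<lambda>x. f x * g x)"
proof -
  obtain B where B: "\<And>x. \<bar>f x\<bar> \<le> B"
    using f(2) by (auto simp: bounded_iff)
  show ?thesis
  proof (rule Bochner_Integration.integrable_bound)
    show "integrable lborel (\<lambda>x. B * g x)"
      using g by simp
    show "(\<lambda>x. f x * g x) \<in> borel_measurable lborel"
      using f(1) borel_measurable_integrable[OF g] by simp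
    have "\<bar>f x * g x\<bar> \<le> \<bar>B * g x\<bar>" for x
      using B[of x] by (simp add: abs_mult mult_right_mono)
    then show "AE x in lborel. norm (f x * g x) \<le> norm (B * g x)"
      by simp
  qed
qed

lemma fun_ideal_integrable:
  assumes "\<And>f. f \<in> G \<Longrightarrow> bounded (range f)" and "G \<subseteq> borel_measurable borel"
    and J: "\<And>f. f \<in> J \<Longrightarrow> integrable lborel f"
    and f: "f \<in> fun_ideal G J"
  shows "integrable lborel f"
  using f
proof induction
  case (mult f g)
  then show ?case
    using fun_algebra_bounded[OF assms(1)] fun_algebra_measurable[OF assms(2)]
    by (blast intro: integrable_bounded_mult)
qed (use J in auto)

section \<open>Fourier transforms of integrable functions\<close>

text \<open>Integrability of \<open>F'\<close> makes \<open>F t - F (-t)\<close> converge to \<open>\<integral> F'\<close> as \<open>t\<close> grows, and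
  integrability of \<open>F\<close> allows no limit other than 0. So integration by parts on the line has
  no boundary terms, without any decay of \<open>F\<close> being known beforehand.\<close>

lemma integral_deriv_zero:
  fixes F :: "real \<Rightarrow> 'a::euclidean_space"
  assumes deriv: "\<And>x. (F has_vector_derivative F' x) (at x)"
    and cont: "continuous_on UNIV F'"
    and F: "integrable lborel F" and F': "integrable lborel F'"
  shows "(LINT x|lborel. F' x) = 0"
proof (rule ccontr)
  define L where "L = (LINT x|lborel. F' x)"
  assume "(LINT x|lborel. F' x) \<noteq> 0"
  then have L: "norm L > 0"
    by (simp add: L_def)
  define u where "u x = F x - F (- x)" for x
  have u: "integrable lborel u"
    unfolding u_def using F lborel_integrable_real_affine[OF F, of "-1" 0] by simp
  have [measurable]: "F' \<in> borel_measurable borel"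
    using cont by (rule borel_measurable_continuous_onI)
  have "((\<lambda>t. LINT x|lborel. indicator {-t..t} x *\<^sub>R F' x) \<longlongrightarrow> L) at_top"
    unfolding L_def
  proof (rule integral_dominated_convergence_at_top[where w = "\<lambda>x. norm (F' x)"])
    show "AE x in lborel. ((\<lambda>t. indicator {-t..t} x *\<^sub>R F' x) \<longlongrightarrow> F' x) at_top"
    proof (rule AE_I2, rule tendsto_eventually)
      fix x :: real
      show "\<forall>\<^sub>F t in at_top. indicator {-t..t} x *\<^sub>R F' x = F' x"
        using eventually_ge_at_top[of "\<bar>x\<bar>"] by eventually_elim (auto simp: indicator_def abs_le_iff)
    qed
  qed (use F' in \<open>auto simp: indicator_def\<close>)
  moreover have "\<forall>\<^sub>F t in at_top. (LINT x|lborel. indicator {-t..t} x *\<^sub>R F' x) = u t"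
    using eventually_ge_at_top[of 0]
  proof eventually_elim
    case (elim t)
    then show ?case
      unfolding u_def
      by (intro integral_FTC_Icc)
        (auto intro: has_vector_derivative_at_within[OF deriv] continuous_on_subset[OF cont])
  qed
  ultimately have "(u \<longlongrightarrow> L) at_top"
    by (simp add: tendsto_cong)
  then have "\<forall>\<^sub>F t in at_top. norm L / 2 < norm (u t)"
    by (intro order_tendstoD(1)[OF tendsto_norm]) (use L in auto)
  then obtain b where b: "\<And>t. b \<le> t \<Longrightarrow> norm L / 2 < norm (u t)"
    by (auto simp: eventually_at_top_linorder)
  have le: "t * (norm L / 2) \<le> (LINT x|lborel. norm (u x))" if "0 \<le> t" for t
  proof -
    \<comment> \<open>\<open>u\<close> stays above \<open>norm L / 2\<close> on an interval of arbitrary length \<open>t\<close>\<close>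
    have "t * (norm L / 2) = (LINT x|lborel. indicator {b..b+t} x * (norm L / 2))"
      using that by simp
    also have "\<dots> \<le> (LINT x|lborel. norm (u x))"
    proof (rule integral_mono)
      show "indicator {b..b+t} x * (norm L / 2) \<le> norm (u x)" for x
        using b[of x] by (auto simp: indicator_def)
      show "integrable lborel (\<lambda>x. indicator {b..b+t} x * (norm L / 2))"
        by (intro integrable_mult_left integrable_real_indicator) (auto simp: emeasure_lborel_Icc_eq)
    qed (use u in auto)
    finally show ?thesis .
  qed
  define I where "I = (LINT x|lborel. norm (u x))"
  have "0 \<le> I"
    by (simp add: I_def)
  with L le[of "2 * (I + 1) / norm L"] show False
    by (simp add: I_def)
qed

lemma fourier_eq_lborel:
  assumes [measurable]: "f \<in> borel_measurable borel"
  shows "fourier f \<xi> = (LINT x|lborel. exp (- (\<i> * of_real (x * \<xi>))) * f x)"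
  unfolding fourier_def by (rule integral_completion) measurable

lemma norm_exp_imaginary [simp]: "norm (exp (- (\<i> * complex_of_real t))) = 1"
  using norm_exp_i_times[of "- t"] by simp

lemma integrable_modulated:
  assumes f: "integrable lborel f"
  shows "integrable lborel (\<lambda>x. exp (- (\<i> * of_real (x * \<xi>))) * (f x :: complex))"
proof (rule Bochner_Integration.integrable_bound[OF f])
  have [measurable]: "f \<in> borel_measurable borel"
    using f by auto
  show "(\<lambda>x. exp (- (\<i> * of_real (x * \<xi>))) * f x) \<in> borel_measurable lborel"
    by measurable
qed (simp add: norm_mult del: of_real_mult)

lemma norm_fourier_le:
  assumes f: "integrable lborel f"
  shows "norm (fourier f \<xi>) \<le> (LINT x|lborel. norm (f x))"
proof -
  have [measurable]: "f \<in> borel_measurable borel"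
    using f by auto
  have "norm (fourier f \<xi>) \<le> (LINT x|lborel. norm (exp (- (\<i> * of_real (x * \<xi>))) * f x))"
    unfolding fourier_eq_lborel[OF \<open>f \<in> borel_measurable borel\<close>] by (rule integral_norm_bound)
  then show ?thesis
    by (simp add: norm_mult del: of_real_mult)
qed

lemma fourier_measurable:
  assumes f: "integrable lborel f"
  shows "fourier f \<in> borel_measurable borel"
proof -
  have [measurable]: "f \<in> borel_measurable borel"
    using f by auto
  have "(\<lambda>\<xi>. LINT x|lborel. exp (- (\<i> * of_real (x * \<xi>))) * f x) \<in> borel_measurable borel"
    by measurable
  moreover have "fourier f = (\<lambda>\<xi>. LINT x|lborel. exp (- (\<i> * of_real (x * \<xi>))) * f x)"
    by (intro ext fourier_eq_lborel) simp
  ultimately show ?thesis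
    by simp
qed

text \<open>The function \<open>x \<mapsto> exp (- i x \<xi>) f x\<close> is integrable together with its derivative, so the
  integral of the latter vanishes.\<close>

lemma fourier_deriv:
  fixes f f' :: "real \<Rightarrow> complex"
  assumes deriv: "\<And>x. (f has_vector_derivative f' x) (at x)"
    and cont: "continuous_on UNIV f'"
    and f: "integrable lborel f" and f': "integrable lborel f'"
  shows "fourier f' \<xi> = \<i> * of_real \<xi> * fourier f \<xi>"
proof -
  let ?e = "\<lambda>x. exp (- (\<i> * of_real (x * \<xi>)))"
  have contf: "continuous_on UNIV f"
    using deriv by (auto simp: continuous_on_eq_continuous_at intro: has_vector_derivative_continuous)
  have e: "(?e has_vector_derivative (- (\<i> * of_real \<xi>)) * ?e x) (at x)" for x
    using exp_scaleR_has_vector_derivative_right[of "- (\<i> * of_real \<xi>)" x UNIV]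
    by (simp add: scaleR_conv_of_real mult_ac)
  have "(LINT x|lborel. ?e x * f' x - (\<i> * of_real \<xi>) * (?e x * f x)) = 0"
  proof (rule integral_deriv_zero[where F = "\<lambda>x. ?e x * f x"])
    show "((\<lambda>x. ?e x * f x) has_vector_derivative
        ?e x * f' x - (\<i> * of_real \<xi>) * (?e x * f x)) (at x)" for x
      using has_vector_derivative_mult[OF e deriv, of x] by (simp add: algebra_simps)
    show "continuous_on UNIV (\<lambda>x. ?e x * f' x - (\<i> * of_real \<xi>) * (?e x * f x))"
      by (intro continuous_intros cont contf)
  qed (intro Bochner_Integration.integrable_diff integrable_mult_right integrable_modulated f f')+
  then have "(LINT x|lborel. ?e x * f' x) = \<i> * of_real \<xi> * (LINT x|lborel. ?e x * f x)"
    by (subst (asm) Bochner_Integration.integral_diff)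
      (use integrable_modulated[OF f] integrable_modulated[OF f'] in auto)
  moreover have "f \<in> borel_measurable borel" "f' \<in> borel_measurable borel"
    using f f' by auto
  ultimately show ?thesis
    by (simp add: fourier_eq_lborel)
qed

text \<open>For integrable functions this is Fubini's theorem. It says that the distributional Fourier
  transform of \<open>f\<close> is the regular distribution of the classical one.\<close>

lemma fourier_multiplication_formula:
  fixes f g :: "real \<Rightarrow> complex"
  assumes f: "integrable lborel f" and g: "integrable lborel g"
  shows "(LINT x|lborel. f x * fourier g x) = (LINT x|lborel. fourier f x * g x)"
proof -
  have [measurable]: "f \<in> borel_measurable borel" "g \<in> borel_measurable borel"
    using f g by auto
  let ?h = "\<lambda>x y. exp (- (\<i> * of_real (x * y))) * f x * g y"
  have "integrable (lborel \<Otimes>\<^sub>M lborel) (case_prod ?h)"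
  proof (rule lborel_pair.Fubini_integrable)
    have "(LINT y|lborel. norm (case (x, y) of (x, y) \<Rightarrow> ?h x y)) =
        norm (f x) * (LINT y|lborel. norm (g y))" for x
      by (simp add: norm_mult del: of_real_mult)
    then show "integrable lborel (\<lambda>x. LINT y|lborel. norm (case (x, y) of (x, y) \<Rightarrow> ?h x y))"
      using f by simp
    show "AE x in lborel. integrable lborel (\<lambda>y. case (x, y) of (x, y) \<Rightarrow> ?h x y)"
    proof (rule AE_I2)
      fix x
      have "integrable lborel (\<lambda>y. f x * (exp (- (\<i> * of_real (y * x))) * g y))"
        by (intro integrable_mult_right integrable_modulated g)
      then show "integrable lborel (\<lambda>y. case (x, y) of (x, y) \<Rightarrow> ?h x y)"
        by (simp add: mult_ac)
    qed
  qed measurable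
  then have "(LINT y|lborel. LINT x|lborel. ?h x y) = (LINT x|lborel. LINT y|lborel. ?h x y)"
    by (rule lborel_pair.Fubini_integral)
  moreover have "(\<lambda>y. LINT x|lborel. ?h x y) = (\<lambda>y. fourier f y * g y)"
    by (simp add: fourier_eq_lborel)
  moreover have "(\<lambda>x. LINT y|lborel. ?h x y) = (\<lambda>x. f x * fourier g x)"
  proof
    fix x
    have "(LINT y|lborel. ?h x y) = (LINT y|lborel. f x * (exp (- (\<i> * of_real (y * x))) * g y))"
      by (simp add: mult_ac)
    then show "(LINT y|lborel. ?h x y) = f x * fourier g x"
      by (simp add: fourier_eq_lborel)
  qed
  ultimately show ?thesis
    by (simp only:)
qed

section \<open>Smooth functions with integrable derivatives are in every Sobolev space\<close>

lemma schwartz_continuous: "\<psi> \<in> schwartz \<Longrightarrow> continuous_on UNIV \<psi>"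
  unfolding schwartz_def smooth_on_def
  by (metis (no_types, lifting) UNIV_I continuous_at_imp_continuous_on
      differentiable_imp_continuous_within mem_Collect_eq nth_deriv_0)

lemma schwartz_bounded:
  assumes "\<psi> \<in> schwartz"
  shows "norm (of_real (x ^ m) * nth_deriv n \<psi> x) \<le> schwartz_seminorm m n \<psi>"
proof -
  have "bounded (range (\<lambda>x. of_real (x ^ m) * nth_deriv n \<psi> x))"
    using assms by (simp add: schwartz_def)
  then have "bdd_above (range (\<lambda>x. norm (of_real (x ^ m) * nth_deriv n \<psi> x)))"
    by (intro bounded_imp_bdd_above) (simp add: bounded_norm_comp)
  then show ?thesis
    unfolding schwartz_seminorm_def by (rule cSUP_upper2) auto
qed

text \<open>Already \<open>\<psi>\<close> and \<open>x\<^sup>2 \<psi>\<close> being bounded gives integrability.\<close>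

lemma schwartz_integrable:
  assumes \<psi>: "\<psi> \<in> schwartz"
  shows "integrable lborel \<psi>"
proof (rule Bochner_Integration.integrable_bound)
  let ?C = "schwartz_seminorm 0 0 \<psi> + schwartz_seminorm 2 0 \<psi>"
  show "integrable lborel (\<lambda>x. ?C * (1 / (1 + x\<^sup>2)))"
    by (intro integrable_mult_right integrable_Cauchy_kernel)
  show "\<psi> \<in> borel_measurable lborel"
    using schwartz_continuous[OF \<psi>] by (auto intro: borel_measurable_continuous_onI)
  have "norm (\<psi> x) \<le> norm (?C * (1 / (1 + x\<^sup>2)))" for x
  proof -
    have pos: "0 < 1 + x\<^sup>2"
      by (simp add: add_pos_nonneg)
    have "norm (\<psi> x) * (1 + x\<^sup>2) \<le> ?C"
      using schwartz_bounded[OF \<psi>, of x 0 0] schwartz_bounded[OF \<psi>, of x 2 0]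
      by (simp add: norm_mult norm_power algebra_simps)
    then have "norm (\<psi> x) \<le> ?C * (1 / (1 + x\<^sup>2))"
      using pos by (simp add: field_simps)
    also have "\<dots> \<le> norm (?C * (1 / (1 + x\<^sup>2)))"
      unfolding real_norm_def by (rule abs_ge_self)
    finally show ?thesis .
  qed
  then show "AE x in lborel. norm (\<psi> x) \<le> norm (?C * (1 / (1 + x\<^sup>2)))"
    by simp
qed

lemma integrable_mult_schwartz:
  assumes f: "integrable lborel f" and \<psi>: "\<psi> \<in> schwartz"
  shows "integrable lborel (\<lambda>x. f x * \<psi> x)"
    and "norm (LINT x|lborel. f x * \<psi> x) \<le> (LINT x|lborel. norm (f x)) * schwartz_seminorm 0 0 \<psi>"
proof -
  have le: "norm (f x * \<psi> x) \<le> norm (f x) * schwartz_seminorm 0 0 \<psi>" for x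
    using schwartz_bounded[OF \<psi>, of x 0 0] by (simp add: norm_mult mult_left_mono)
  have int: "integrable lborel (\<lambda>x. norm (f x) * schwartz_seminorm 0 0 \<psi>)"
    using f by simp
  have [measurable]: "f \<in> borel_measurable borel" "\<psi> \<in> borel_measurable borel"
    using f schwartz_integrable[OF \<psi>] by auto
  show *: "integrable lborel (\<lambda>x. f x * \<psi> x)"
    by (rule Bochner_Integration.integrable_bound[OF int])
      (use le in \<open>auto intro: order_trans[OF _ abs_ge_self]\<close>)
  have "norm (LINT x|lborel. f x * \<psi> x) \<le> (LINT x|lborel. norm (f x * \<psi> x))"
    by (rule integral_norm_bound)
  also have "\<dots> \<le> (LINT x|lborel. norm (f x) * schwartz_seminorm 0 0 \<psi>)"
    by (rule integral_mono) (use * int le in auto)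
  finally show "norm (LINT x|lborel. f x * \<psi> x) \<le>
      (LINT x|lborel. norm (f x)) * schwartz_seminorm 0 0 \<psi>"
    by simp
qed

lemma regular_distribution_lborel:
  assumes [measurable]: "f \<in> borel_measurable borel" "\<psi> \<in> borel_measurable borel"
  shows "regular_distribution f \<psi> = (LINT x|lborel. f x * \<psi> x)"
  unfolding regular_distribution_def by (rule integral_completion) measurable

lemma tempered_distribution_integrable:
  assumes f: "integrable lborel f"
  shows "tempered_distribution (regular_distribution f)"
proof -
  have [measurable]: "f \<in> borel_measurable borel"
    using f by auto
  have meas: "\<psi> \<in> borel_measurable borel" if "\<psi> \<in> schwartz" for \<psi>
    using schwartz_integrable[OF that] by auto
  have reg: "regular_distribution f \<psi> = (LINT x|lborel. f x * \<psi> x)"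
    if "\<psi> \<in> borel_measurable borel" for \<psi>
    using that by (intro regular_distribution_lborel) auto
  show ?thesis
    unfolding tempered_distribution_def
  proof (intro conjI ballI allI exI[of _ "LINT x|lborel. norm (f x)"] exI[of _ 0])
    fix \<psi> \<eta>
    assume *: "\<psi> \<in> schwartz" "\<eta> \<in> schwartz"
    show "regular_distribution f (\<lambda>x. \<psi> x + \<eta> x) = regular_distribution f \<psi> + regular_distribution f \<eta>"
      using meas[OF *(1)] meas[OF *(2)] integrable_mult_schwartz(1)[OF f *(1)] integrable_mult_schwartz(1)[OF f *(2)]
      by (simp add: reg distrib_left)
  next
    fix c \<psi>
    assume *: "\<psi> \<in> schwartz"
    show "regular_distribution f (\<lambda>x. c * \<psi> x) = c * regular_distribution f \<psi>"
      using meas[OF *] by (simp add: reg mult.left_commute)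
  next
    fix \<psi>
    assume *: "\<psi> \<in> schwartz"
    show "norm (regular_distribution f \<psi>) \<le>
        (LINT x|lborel. norm (f x)) * (\<Sum>m\<le>0. \<Sum>n\<le>0. schwartz_seminorm m n \<psi>)"
      using meas[OF *] integrable_mult_schwartz(2)[OF f *] by (simp add: reg)
  qed
qed

text \<open>Each factor \<open>1 + \<xi>\<^sup>2\<close> is absorbed by replacing \<open>h\<close> with \<open>h - h''\<close>, which stays in the class.
  Multiplying by \<open>1 + \<xi>\<^sup>2\<close> rather than by powers of \<open>\<xi>\<close> yields the Sobolev weight directly.\<close>

lemma fourier_rapid_decay:
  assumes int: "\<And>f. f \<in> C \<Longrightarrow> integrable lborel f"
    and deriv: "\<And>f. f \<in> C \<Longrightarrow> \<exists>f'\<in>C. \<forall>x. (f has_vector_derivative f' x) (at x)"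
    and diff: "\<And>f g. f \<in> C \<Longrightarrow> g \<in> C \<Longrightarrow> (\<lambda>x. f x - g x) \<in> C"
    and f: "f \<in> C"
  shows "\<exists>h\<in>C. \<forall>\<xi>. of_real ((1 + \<xi>\<^sup>2) ^ k) * fourier f \<xi> = fourier h \<xi>"
proof (induction k)
  case 0
  then show ?case
    using f by auto
next
  case (Suc k)
  then obtain h where h: "h \<in> C" "\<And>\<xi>. of_real ((1 + \<xi>\<^sup>2) ^ k) * fourier f \<xi> = fourier h \<xi>"
    by blast
  obtain h' where h': "h' \<in> C" "\<And>x. (h has_vector_derivative h' x) (at x)"
    using deriv[OF h(1)] by blast
  obtain h'' where h'': "h'' \<in> C" "\<And>x. (h' has_vector_derivative h'' x) (at x)"
    using deriv[OF h'(1)] by blast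
  obtain h''' where h''': "\<And>x. (h'' has_vector_derivative h''' x) (at x)"
    using deriv[OF h''(1)] by blast
  have cont: "continuous_on UNIV h'" "continuous_on UNIV h''"
    using h''(2) h'''
    by (auto simp: continuous_on_eq_continuous_at intro: has_vector_derivative_continuous)
  have "fourier h'' \<xi> = - of_real (\<xi>\<^sup>2) * fourier h \<xi>" for \<xi>
  proof -
    have "fourier h'' \<xi> = (\<i> * of_real \<xi>) * ((\<i> * of_real \<xi>) * fourier h \<xi>)"
      using fourier_deriv[OF h'(2) cont(1) int[OF h(1)] int[OF h'(1)], of \<xi>]
        fourier_deriv[OF h''(2) cont(2) int[OF h'(1)] int[OF h''(1)], of \<xi>]
      by simp
    also have "\<dots> = (\<i> * \<i>) * (of_real \<xi> * of_real \<xi>) * fourier h \<xi>"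
      by (simp only: mult_ac)
    finally show ?thesis
      by (simp add: power2_eq_square)
  qed
  moreover have "fourier (\<lambda>x. h x - h'' x) \<xi> = fourier h \<xi> - fourier h'' \<xi>" for \<xi>
  proof -
    have [measurable]: "h \<in> borel_measurable borel" "h'' \<in> borel_measurable borel"
      using int[OF h(1)] int[OF h''(1)] by auto
    show ?thesis
      using integrable_modulated[OF int[OF h(1)], of \<xi>] integrable_modulated[OF int[OF h''(1)], of \<xi>]
      by (simp add: fourier_eq_lborel right_diff_distrib)
  qed
  ultimately have "of_real ((1 + \<xi>\<^sup>2) ^ Suc k) * fourier f \<xi> = fourier (\<lambda>x. h x - h'' x) \<xi>" for \<xi>
    unfolding h(2)[symmetric] by (simp add: algebra_simps)
  then show ?case
    using diff[OF h(1) h''(1)] by blast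
qed

text \<open>For \<open>k \<ge> s/2 + 1\<close> the weighted transform is bounded by a multiple of \<open>1 / (1 + \<xi>\<^sup>2)\<close>, which
  is square integrable. The same estimate covers negative orders.\<close>

lemma sobolev_inf_class:
  assumes int: "\<And>f. f \<in> C \<Longrightarrow> integrable lborel f"
    and deriv: "\<And>f. f \<in> C \<Longrightarrow> \<exists>f'\<in>C. \<forall>x. (f has_vector_derivative f' x) (at x)"
    and diff: "\<And>f g. f \<in> C \<Longrightarrow> g \<in> C \<Longrightarrow> (\<lambda>x. f x - g x) \<in> C"
    and f: "f \<in> C"
  shows "f \<in> sobolev_inf"
proof -
  have [measurable]: "f \<in> borel_measurable borel"
    using int[OF f] by auto
  have [measurable]: "fourier f \<in> borel_measurable borel"
    by (rule fourier_measurable[OF int[OF f]])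
  have "f \<in> sobolev_fun s" for s
  proof -
    define k where "k = nat \<lceil>\<bar>s\<bar> / 2\<rceil> + 1"
    have k: "s / 2 \<le> real k - 1"
      unfolding k_def by simp linarith
    obtain h where h: "h \<in> C" "\<And>\<xi>. of_real ((1 + \<xi>\<^sup>2) ^ k) * fourier f \<xi> = fourier h \<xi>"
      using fourier_rapid_decay[OF int deriv diff f, of k] by blast
    define B where "B = (LINT x|lborel. norm (h x))"
    have bound: "(1 + \<xi>\<^sup>2) powr (s / 2) * norm (fourier f \<xi>) \<le> B / (1 + \<xi>\<^sup>2)" for \<xi>
    proof -
      have one: "1 \<le> 1 + \<xi>\<^sup>2"
        by simp
      then have pos: "0 < 1 + \<xi>\<^sup>2"
        by linarith
      have "(1 + \<xi>\<^sup>2) powr (s / 2) \<le> (1 + \<xi>\<^sup>2) powr (real k - 1)"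
        using k one by (intro powr_mono) auto
      also have "\<dots> = (1 + \<xi>\<^sup>2) ^ k / (1 + \<xi>\<^sup>2)"
        using pos by (simp add: powr_diff powr_realpow)
      finally have "(1 + \<xi>\<^sup>2) powr (s / 2) * norm (fourier f \<xi>) \<le>
          (1 + \<xi>\<^sup>2) ^ k / (1 + \<xi>\<^sup>2) * norm (fourier f \<xi>)"
        by (rule mult_right_mono) simp
      also have "\<dots> = norm (of_real ((1 + \<xi>\<^sup>2) ^ k) * fourier f \<xi>) / (1 + \<xi>\<^sup>2)"
        using pos by (simp only: norm_mult norm_of_real) simp
      also have "\<dots> \<le> B / (1 + \<xi>\<^sup>2)"
        unfolding h(2) B_def using pos norm_fourier_le[OF int[OF h(1)], of \<xi>]
        by (intro divide_right_mono) auto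
      finally show ?thesis .
    qed
    have "integrable lborel (\<lambda>\<xi>. (norm (complex_of_real ((1 + \<xi>\<^sup>2) powr (s / 2)) * fourier f \<xi>))\<^sup>2)"
    proof (rule Bochner_Integration.integrable_bound)
      show "integrable lborel (\<lambda>\<xi>::real. B\<^sup>2 * (1 / (1 + \<xi>\<^sup>2)))"
        by (intro integrable_mult_right integrable_Cauchy_kernel)
      have "(norm (complex_of_real ((1 + \<xi>\<^sup>2) powr (s / 2)) * fourier f \<xi>))\<^sup>2 \<le> B\<^sup>2 * (1 / (1 + \<xi>\<^sup>2))"
        for \<xi>
      proof -
        have pos: "0 < 1 + \<xi>\<^sup>2"
          by (simp add: add_pos_nonneg)
        have "(norm (complex_of_real ((1 + \<xi>\<^sup>2) powr (s / 2)) * fourier f \<xi>))\<^sup>2 \<le> (B / (1 + \<xi>\<^sup>2))\<^sup>2"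
          using bound[of \<xi>] by (intro power_mono) (auto simp: norm_mult)
        also have "\<dots> = B\<^sup>2 * (1 / (1 + \<xi>\<^sup>2)) * (1 / (1 + \<xi>\<^sup>2))"
          by (simp add: power2_eq_square)
        also have "\<dots> \<le> B\<^sup>2 * (1 / (1 + \<xi>\<^sup>2)) * 1"
          using pos by (intro mult_left_mono) auto
        finally show ?thesis
          by simp
      qed
      then show "AE \<xi> in lborel. norm ((norm (complex_of_real ((1 + \<xi>\<^sup>2) powr (s / 2)) * fourier f \<xi>))\<^sup>2)
          \<le> norm (B\<^sup>2 * (1 / (1 + \<xi>\<^sup>2)))"
        by simp
    qed measurable
    then have L2: "(\<lambda>\<xi>. complex_of_real ((1 + \<xi>\<^sup>2) powr (s / 2)) * fourier f \<xi>) \<in> L2"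
      unfolding L2_def by (auto simp: integrable_completion intro!: measurable_completion)
    have dual: "fourier_distribution (regular_distribution f) \<psi> = regular_distribution (fourier f) \<psi>"
      if \<psi>: "\<psi> \<in> schwartz" for \<psi>
    proof -
      have [measurable]: "\<psi> \<in> borel_measurable borel" "fourier \<psi> \<in> borel_measurable borel"
        using schwartz_integrable[OF \<psi>] by (auto intro: fourier_measurable)
      show ?thesis
        unfolding fourier_distribution_def
        using fourier_multiplication_formula[OF int[OF f] schwartz_integrable[OF \<psi>]]
        by (simp add: regular_distribution_lborel)
    qed
    have "integrable lebesgue (\<lambda>x. f x * \<psi> x)" if \<psi>: "\<psi> \<in> schwartz" for \<psi>
    proof -
      have [measurable]: "\<psi> \<in> borel_measurable borel"
        using schwartz_integrable[OF \<psi>] by auto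
      show ?thesis
        using integrable_mult_schwartz(1)[OF int[OF f] \<psi>] by (simp add: integrable_completion)
    qed
    moreover have "regular_distribution f \<in> sobolev s"
      unfolding sobolev_def using tempered_distribution_integrable[OF int[OF f]] L2 dual by blast
    ultimately show ?thesis
      unfolding sobolev_fun_def by (auto intro: measurable_completion)
  qed
  then show ?thesis
    by (simp add: sobolev_inf_def)
qed

section \<open>Solutions below the wave speed\<close>

locale wave_solution =
  fixes \<mu> a :: real and \<phi> :: "real \<Rightarrow> real"
  assumes le_speed: "\<And>x. \<phi> x \<le> \<mu>"
    and solution: "is_solution \<mu> a \<phi>"
begin

definition w :: "real \<Rightarrow> real" where
  "w = Lop (\<lambda>y. (\<phi> y)\<^sup>2)"

definition w' :: "real \<Rightarrow> real" where
  "w' = Lop' (\<lambda>y. (\<phi> y)\<^sup>2)"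

definition gap :: "real \<Rightarrow> real" where
  "gap x = \<mu> - \<phi> x"

definition inv_gap :: "real \<Rightarrow> real" where
  "inv_gap x = 1 / gap x"

lemma square_bound: obtains M where "\<And>y. \<bar>(\<phi> y)\<^sup>2\<bar> \<le> M"
proof -
  obtain B where "\<And>y. \<bar>\<phi> y\<bar> \<le> B"
    using solution by (auto simp: is_solution_def bounded_iff)
  then have "\<bar>(\<phi> y)\<^sup>2\<bar> \<le> B\<^sup>2" for y
    using power_mono[of "\<bar>\<phi> y\<bar>" B 2] by simp
  then show ?thesis
    by (rule that)
qed

lemma gap_square: "(gap x)\<^sup>2 = \<mu>\<^sup>2 + 2 * a - 3 * w x"
proof -
  have "- \<mu> * \<phi> x + 1/2 * (\<phi> x)\<^sup>2 + 3/2 * w x = a"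
    using solution by (simp add: is_solution_def w_def)
  then show ?thesis
    by (simp add: gap_def power2_diff)
qed

lemma gap_eq: "gap = (\<lambda>x. sqrt (\<mu>\<^sup>2 + 2 * a - 3 * w x))"
  using le_speed by (auto simp: gap_def simp flip: gap_square)

lemma w_nonneg: "0 \<le> w x"
  unfolding w_def by (rule Lop_nonneg) simp

text \<open>The first gain of regularity: \<open>w\<close> is continuous although \<open>\<phi>\<close> is only known to be bounded and
  measurable, and \<open>\<phi>\<close> inherits this through the square root.\<close>

lemma continuous_gap: "continuous_on UNIV gap"
proof -
  obtain M where M: "\<And>y. \<bar>(\<phi> y)\<^sup>2\<bar> \<le> M"
    using square_bound by blast
  have "(\<lambda>y. (\<phi> y)\<^sup>2) \<in> borel_measurable lebesgue"
    using solution by (auto simp: is_solution_def)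
  from isCont_Lop[OF this _ M] have "continuous_on UNIV w"
    by (simp add: w_def continuous_on_eq_continuous_at)
  then show ?thesis
    unfolding gap_eq by (intro continuous_intros)
qed

lemma \<phi>_eq: "\<phi> = (\<lambda>x. \<mu> + (-1) * gap x)"
  by (simp add: gap_def)

lemma continuous_\<phi>: "continuous_on UNIV \<phi>"
  by (subst \<phi>_eq) (intro continuous_intros continuous_gap)

lemma continuous_square: "continuous_on UNIV (\<lambda>y. (\<phi> y)\<^sup>2)"
  by (intro continuous_intros continuous_\<phi>)

lemma w_deriv: "(w has_real_derivative w' x) (at x)"
  unfolding w_def w'_def
  by (rule square_bound) (rule has_derivative_Lop[OF continuous_square])

lemma w'_deriv: "(w' has_real_derivative w x + (-1) * (\<phi> x * \<phi> x)) (at x)"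
proof (rule square_bound)
  fix M
  assume "\<And>y. \<bar>(\<phi> y)\<^sup>2\<bar> \<le> M"
  from has_derivative_Lop'[OF continuous_square this] show ?thesis
    by (simp add: w_def w'_def power2_eq_square)
qed

lemma abs_w'_le: "\<bar>w' x\<bar> \<le> w x"
  unfolding w_def w'_def
  by (rule square_bound) (rule abs_Lop'_le[OF continuous_square], auto)

lemma gap_deriv:
  assumes "\<phi> x < \<mu>"
  shows "(gap has_real_derivative (-3/2) * (w' x * inv_gap x)) (at x)"
proof -
  have pos: "0 < gap x"
    using assms by (simp add: gap_def)
  have sqrt: "sqrt (\<mu>\<^sup>2 + 2 * a - 3 * w x) = gap x"
    by (simp add: gap_eq)
  have "0 < \<mu>\<^sup>2 + 2 * a - 3 * w x"
    using pos by (simp flip: gap_square)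
  from DERIV_real_sqrt[OF this]
  have "((\<lambda>x. sqrt (\<mu>\<^sup>2 + 2 * a - 3 * w x)) has_real_derivative
      inverse (gap x) / 2 * (- (3 * w' x))) (at x)"
    unfolding sqrt by (rule DERIV_chain2) (auto intro!: derivative_eq_intros w_deriv)
  then show ?thesis
    unfolding gap_eq[symmetric] by (simp add: inv_gap_def inverse_eq_divide mult.commute)
qed

lemma \<phi>_deriv:
  assumes "\<phi> x < \<mu>"
  shows "(\<phi> has_real_derivative (3/2) * inv_gap x * w' x) (at x)"
proof -
  have "((\<lambda>x. \<mu> + (-1) * gap x) has_real_derivative (3/2) * inv_gap x * w' x) (at x)"
    by (auto intro!: derivative_eq_intros gap_deriv[OF assms])
  then show ?thesis
    by (simp only: \<phi>_eq[symmetric])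
qed

lemma inv_gap_deriv:
  assumes "\<phi> x < \<mu>"
  shows "(inv_gap has_real_derivative (3/2) * (w' x * (inv_gap x * (inv_gap x * inv_gap x)))) (at x)"
proof -
  have "gap x \<noteq> 0"
    using assms by (simp add: gap_def)
  then have "((\<lambda>x. 1 / gap x) has_real_derivative
      (3/2) * (w' x * (inv_gap x * (inv_gap x * inv_gap x)))) (at x)"
    by (auto intro!: derivative_eq_intros gap_deriv[OF assms]
        simp: inv_gap_def power2_eq_square field_simps)
  then show ?thesis
    by (simp add: inv_gap_def[abs_def])
qed

definition gens :: "(real \<Rightarrow> real) set" where
  "gens = {w, w', gap, inv_gap}"

lemma gens_in_algebra:
  "w \<in> fun_algebra gens" "w' \<in> fun_algebra gens" "gap \<in> fun_algebra gens"
  "inv_gap \<in> fun_algebra gens"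
  by (auto simp: gens_def intro: fun_algebra.gen)

lemma \<phi>_in_algebra: "\<phi> \<in> fun_algebra gens"
  by (subst \<phi>_eq) (intro fun_algebra.add fun_algebra.mult fun_algebra.const gens_in_algebra)

text \<open>The derivatives are \<open>w'\<close>, \<open>w - \<phi>\<^sup>2\<close>, \<open>- 3w'/(2\<sigma>)\<close> and \<open>3w'/(2\<sigma>\<^sup>3)\<close>, where \<open>\<sigma>\<close> is the gap
  \<open>\<mu> - \<phi>\<close>. Including \<open>1/\<sigma>\<close> among the generators is what makes the algebra closed.\<close>

lemma gens_deriv:
  assumes U: "\<And>x. x \<in> U \<Longrightarrow> \<phi> x < \<mu>" and f: "f \<in> gens"
  shows "\<exists>f'\<in>fun_algebra gens. \<forall>x\<in>U. (f has_real_derivative f' x) (at x)"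
proof -
  consider "f = w" | "f = w'" | "f = gap" | "f = inv_gap"
    using f by (auto simp: gens_def)
  then show ?thesis
  proof cases
    case 1
    then show ?thesis
      using w_deriv by (intro bexI[of _ w'] gens_in_algebra) auto
  next
    case 2
    then show ?thesis
      using w'_deriv
      by (intro bexI[of _ "\<lambda>x. w x + (-1) * (\<phi> x * \<phi> x)"] fun_algebra.add fun_algebra.mult
          fun_algebra.const gens_in_algebra \<phi>_in_algebra) auto
  next
    case 3
    then show ?thesis
      using gap_deriv U
      by (intro bexI[of _ "\<lambda>x. (-3/2) * (w' x * inv_gap x)"] fun_algebra.mult
          fun_algebra.const gens_in_algebra) auto
  next
    case 4
    then show ?thesis
      using inv_gap_deriv U
      by (intro bexI[of _ "\<lambda>x. (3/2) * (w' x * (inv_gap x * (inv_gap x * inv_gap x)))"]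
          fun_algebra.mult fun_algebra.const gens_in_algebra) auto
  qed
qed

lemma algebra_vector_deriv:
  assumes "\<And>x. x \<in> U \<Longrightarrow> \<phi> x < \<mu>" and "f \<in> fun_algebra gens"
  shows "\<exists>f'\<in>fun_algebra gens. \<forall>x\<in>U. (f has_vector_derivative f' x) (at x)"
  using fun_algebra_deriv[OF gens_deriv assms(2), of U] assms(1)
  by (simp add: has_real_derivative_iff_has_vector_derivative)

theorem smooth_below_speed:
  assumes "open U" and "\<And>x. x \<in> U \<Longrightarrow> \<phi> x < \<mu>"
  shows "smooth_on U \<phi>"
  using smooth_on_class[OF assms(1) algebra_vector_deriv[OF assms(2)] \<phi>_in_algebra] by blast

end

text \<open>The gap to the wave speed is bounded below by some \<open>\<delta> > 0\<close>; this is \<open>sup \<phi> < \<mu>\<close> in the form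
  in which it bounds \<open>1 / (\<mu> - \<phi>)\<close>.\<close>

locale uniform_wave_solution = wave_solution +
  fixes \<delta> :: real
  assumes \<delta>_pos: "0 < \<delta>" and gap_ge: "\<And>x. \<delta> \<le> \<mu> - \<phi> x"
begin

lemma below_speed: "\<phi> x < \<mu>"
  using \<delta>_pos gap_ge[of x] by linarith

lemma gens_bounded:
  assumes "f \<in> gens"
  shows "bounded (range f)"
proof -
  obtain M where M: "\<And>y. \<bar>(\<phi> y)\<^sup>2\<bar> \<le> M"
    using square_bound by blast
  have "(\<lambda>y. (\<phi> y)\<^sup>2) \<in> borel_measurable lebesgue"
    using solution by (auto simp: is_solution_def)
  from Lop_le[OF this M] obtain B where B: "\<And>x. w x \<le> B"
    by (auto simp: w_def)
  have "bounded (range w)"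
    using B w_nonneg by (auto simp: bounded_iff)
  moreover have "bounded (range w')"
    using order_trans[OF abs_w'_le B] by (auto simp: bounded_iff)
  moreover have "bounded (range gap)"
    using solution bounded_minus_comp[of "\<lambda>x. \<mu>" UNIV \<phi>]
    by (simp add: is_solution_def gap_def[abs_def])
  moreover have "\<bar>inv_gap x\<bar> \<le> 1 / \<delta>" for x
    using gap_ge[of x] \<delta>_pos by (auto simp: inv_gap_def gap_def intro!: divide_left_mono)
  then have "bounded (range inv_gap)"
    by (auto simp: bounded_iff)
  ultimately show ?thesis
    using assms by (auto simp: gens_def)
qed

theorem bounded_nth_deriv: "bounded (range (nth_deriv n \<phi>))"
proof -
  obtain g where "g \<in> fun_algebra gens" "\<forall>x. nth_deriv n \<phi> x = g x"
    using nth_deriv_in_class[OF open_UNIV algebra_vector_deriv \<phi>_in_algebra] below_speed by blast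
  then show ?thesis
    using fun_algebra_bounded[OF gens_bounded] by (simp add: fun_eq_iff[symmetric])
qed

lemma gens_measurable: "gens \<subseteq> borel_measurable borel"
proof
  fix f
  assume "f \<in> gens"
  then have "\<exists>f'. \<forall>x. (f has_real_derivative f' x) (at x)"
    using gens_deriv[of UNIV] below_speed by blast
  then have "continuous_on UNIV f"
    by (auto simp: continuous_on_eq_continuous_at intro: DERIV_isCont)
  then show "f \<in> borel_measurable borel"
    by (rule borel_measurable_continuous_onI)
qed

text \<open>Unlike the gap, which tends to \<open>\<mu>\<close> for a decaying wave, these three functions are integrable
  when \<open>\<phi>\<close> is in \<open>L\<^sup>2\<close>.\<close>

definition L1_gens :: "(real \<Rightarrow> real) set" where
  "L1_gens = {w, w', \<phi>}"

lemma L1_gens_in_ideal: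
  "w \<in> fun_ideal gens L1_gens" "w' \<in> fun_ideal gens L1_gens" "\<phi> \<in> fun_ideal gens L1_gens"
  by (auto simp: L1_gens_def intro: fun_ideal.gen)

text \<open>Each derivative \<open>w'\<close>, \<open>w - \<phi> \<cdot> \<phi>\<close>, \<open>3/(2\<sigma>) \<cdot> w'\<close> has a factor from \<open>{w, w', \<phi>}\<close> in every term.\<close>

lemma L1_gens_deriv:
  assumes f: "f \<in> L1_gens"
  shows "\<exists>f'\<in>fun_ideal gens L1_gens. \<forall>x\<in>UNIV. (f has_real_derivative f' x) (at x)"
proof -
  consider "f = w" | "f = w'" | "f = \<phi>"
    using f by (auto simp: L1_gens_def)
  then show ?thesis
  proof cases
    case 1
    then show ?thesis
      using w_deriv by (intro bexI[of _ w'] L1_gens_in_ideal) auto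
  next
    case 2
    then show ?thesis
      using w'_deriv
      by (intro bexI[of _ "\<lambda>x. w x + (-1) * (\<phi> x * \<phi> x)"] fun_ideal.add fun_ideal.mult
          fun_algebra.const \<phi>_in_algebra L1_gens_in_ideal) auto
  next
    case 3
    then show ?thesis
      using \<phi>_deriv[OF below_speed]
      by (intro bexI[of _ "\<lambda>x. (3/2) * inv_gap x * w' x"] fun_ideal.mult fun_algebra.mult
          fun_algebra.const gens_in_algebra L1_gens_in_ideal) auto
  qed
qed

text \<open>For \<open>w\<close> and \<open>w'\<close> this is Tonelli's theorem. For \<open>\<phi>\<close>, the equation expresses \<open>a + \<mu>\<phi>\<close> by
  integrable functions, so it remains to see that \<open>a = 0\<close>: otherwise a nonzero constant would be
  square integrable on the line.\<close>

lemma L1_gens_integrable: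
  assumes "\<mu> \<noteq> 0" and "\<phi> \<in> L2" and f: "f \<in> L1_gens"
  shows "integrable lborel f"
proof -
  have meas [measurable]: "\<phi> \<in> borel_measurable borel"
    using continuous_\<phi> by (rule borel_measurable_continuous_onI)
  have sq: "integrable lborel (\<lambda>y. (\<phi> y)\<^sup>2)"
    using assms(2) by (simp add: L2_def integrable_completion)
  have w: "integrable lborel w"
    unfolding w_def by (rule integrable_Lop[OF sq]) simp
  have w': "integrable lborel w'"
  proof (rule Bochner_Integration.integrable_bound[OF w])
    show "w' \<in> borel_measurable lborel"
      using gens_measurable by (auto simp: gens_def)
  qed (use abs_w'_le in \<open>auto intro: order_trans[OF _ abs_ge_self]\<close>)
  define h where "h x = 1/2 * (\<phi> x)\<^sup>2 + 3/2 * w x" for x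
  have h: "integrable lborel h"
    unfolding h_def using sq w by simp
  have h_eq: "h x = a + \<mu> * \<phi> x" for x
    using gap_square[of x] by (simp add: h_def gap_def power2_diff)
  \<comment> \<open>a bounded integrable function is square integrable, and \<open>a = h - \<mu>\<phi>\<close>\<close>
  have "bounded (range h)"
    unfolding h_eq[abs_def]
    by (rule fun_algebra_bounded[OF gens_bounded fun_algebra.add[OF fun_algebra.const
        fun_algebra.mult[OF fun_algebra.const \<phi>_in_algebra]]])
  then have hh: "integrable lborel (\<lambda>x. h x * h x)"
    using h by (intro integrable_bounded_mult) auto
  have "integrable lborel (\<lambda>x::real. a\<^sup>2)"
  proof (rule Bochner_Integration.integrable_bound)
    show "integrable lborel (\<lambda>x. 2 * (h x * h x) + 2 * \<mu>\<^sup>2 * (\<phi> x)\<^sup>2)"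
      using hh sq by simp
    have "a\<^sup>2 \<le> 2 * (h x * h x) + 2 * \<mu>\<^sup>2 * (\<phi> x)\<^sup>2" for x
      using zero_le_power2[of "a + 2 * (\<mu> * \<phi> x)"]
      by (simp add: h_eq power2_eq_square algebra_simps)
    then show "AE x in lborel. norm (a\<^sup>2) \<le> norm (2 * (h x * h x) + 2 * \<mu>\<^sup>2 * (\<phi> x)\<^sup>2)"
      by (auto intro: order_trans[OF _ abs_ge_self])
  qed simp
  then have "a = 0"
    by (auto simp: integrable_iff_bounded ennreal_mult_top split: if_splits)
  then have "\<phi> = (\<lambda>x. h x / \<mu>)"
    using assms(1) by (simp add: h_eq)
  then have "integrable lborel \<phi>"
    using h by simp
  with w w' f show ?thesis
    by (auto simp: L1_gens_def)
qed

theorem in_sobolev_inf: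
  assumes "\<mu> \<noteq> 0" and "\<phi> \<in> L2"
  shows "(\<lambda>x. complex_of_real (\<phi> x)) \<in> sobolev_inf"
proof (rule sobolev_inf_class)
  let ?C = "(\<lambda>f x. complex_of_real (f x)) ` fun_ideal gens L1_gens"
  show "(\<lambda>x. complex_of_real (\<phi> x)) \<in> ?C"
    using L1_gens_in_ideal by blast
  show "integrable lborel f" if "f \<in> ?C" for f
    using that fun_ideal_integrable[OF gens_bounded gens_measurable L1_gens_integrable[OF assms]]
    by auto
  show "\<exists>f'\<in>?C. \<forall>x. (f has_vector_derivative f' x) (at x)" if "f \<in> ?C" for f
  proof -
    obtain g where g: "f = (\<lambda>x. complex_of_real (g x))" "g \<in> fun_ideal gens L1_gens"
      using \<open>f \<in> ?C\<close> by blast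
    obtain g' where "g' \<in> fun_ideal gens L1_gens" "\<forall>x. (g has_real_derivative g' x) (at x)"
      using fun_ideal_deriv[OF gens_deriv L1_gens_deriv g(2)] below_speed by blast
    then show ?thesis
      unfolding g(1) by (auto intro: has_vector_derivative_of_real)
  qed
  show "(\<lambda>x. f x - g x) \<in> ?C" if "f \<in> ?C" "g \<in> ?C" for f g
  proof -
    obtain f0 where f0: "f = (\<lambda>x. complex_of_real (f0 x))" "f0 \<in> fun_ideal gens L1_gens"
      using \<open>f \<in> ?C\<close> by blast
    obtain g0 where g0: "g = (\<lambda>x. complex_of_real (g0 x))" "g0 \<in> fun_ideal gens L1_gens"
      using \<open>g \<in> ?C\<close> by blast
    have "(\<lambda>x. f0 x + (-1) * g0 x) \<in> fun_ideal gens L1_gens"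
      by (intro fun_ideal.add fun_ideal.mult fun_algebra.const f0 g0)
    then show ?thesis
      unfolding f0(1) g0(1) by (rule rev_image_eqI) simp
  qed
qed

end

theorem theorem3p3:
  fixes \<mu> a :: real and \<phi> :: "real \<Rightarrow> real"
  assumes "\<mu> > 0"
    and "- (\<mu>\<^sup>2) / 8 < a" and "a < \<mu>\<^sup>2"
    and "\<And>x. \<phi> x \<le> \<mu>"
    and "is_solution \<mu> a \<phi>"
  shows "((SUP x. \<phi> x) < \<mu> \<longrightarrow>
            smooth_on UNIV \<phi> \<and> (\<forall>n. bounded (range (nth_deriv n \<phi>)))) \<and>
         ((SUP x. \<phi> x) < \<mu> \<and> \<phi> \<in> L2 \<longrightarrow>
            (\<lambda>x. complex_of_real (\<phi> x)) \<in> sobolev_inf) \<and>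
         (\<forall>U. open U \<and> (\<forall>x\<in>U. \<phi> x < \<mu>) \<longrightarrow> smooth_on U \<phi>)"
proof -
  interpret wave_solution \<mu> a \<phi>
    by unfold_locales (fact assms(4,5))+
  have uniform: "uniform_wave_solution \<mu> a \<phi> (\<mu> - (SUP x. \<phi> x))" if "(SUP x. \<phi> x) < \<mu>"
  proof unfold_locales
    have "bdd_above (range \<phi>)"
      by (rule bdd_aboveI[of _ \<mu>]) (use assms(4) in auto)
    then show "\<mu> - (SUP x. \<phi> x) \<le> \<mu> - \<phi> x" for x
      by (simp add: cSUP_upper)
  qed (use that in simp)
  show ?thesis
  proof (intro conjI impI allI; (elim conjE)?)
    assume less: "(SUP x. \<phi> x) < \<mu>"
    then interpret uniform_wave_solution \<mu> a \<phi> "\<mu> - (SUP x. \<phi> x)"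
      by (rule uniform)
    show "smooth_on UNIV \<phi>"
      by (rule smooth_below_speed) (auto intro: below_speed)
    show "bounded (range (nth_deriv n \<phi>))" for n
      by (rule bounded_nth_deriv)
    assume "\<phi> \<in> L2"
    then show "(\<lambda>x. complex_of_real (\<phi> x)) \<in> sobolev_inf"
      using assms(1) by (intro in_sobolev_inf) auto
  next
    fix U
    assume "open U" "\<forall>x\<in>U. \<phi> x < \<mu>"
    then show "smooth_on U \<phi>"
      by (intro smooth_below_speed) auto
  qed
qed

end
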